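(* Consider an instance of the problem $1|pmtn; r_j, p_j=p|F(C_j)$ with integer release times $r_j$, a common integer processing time $p$, and an objective function $F$ that is an increasing function of the completion times. Then in an optimal schedule there are either $0$, $p$, or a multiple of $p$ time intervals between the two time intervals to which one job's subsequent job-parts are assigned; that is, if for some job $j$ and $k\in\{1,\dots,p-1\}$ the job-parts $j.k$ and $j.(k+1)$ are assigned to time intervals $t$ and $t'$ respectively, then $t'-t-1$ is a nonnegative integer multiple of $p$.
   Context: The problem $1|pmtn; r_j, p_j=p|F(C_j)$: there are $n$ jobs $1,\dots,n$ to be processed on a single machine, which can process at most one job at each point in time. Job $j$ has an integer release time $r_j\ge 0$, and all jobs have the same positive integer processing time $p$. Job $j$ becomes available for processing at the moment $r_j$ (it cannot be processed before time $r_j$) and must be processed for a total time of $p$. Preemptions of one job in favor of another are allowed at any (real) time and any (finite) number of times. A schedule specifies which job is processed when: job $j$ is processed on a finite union of intervals of the form $(a,b]$ of real time, and the sets for different jobs are disjoint. It is feasible if no job is processed before its release time and each job is processed for exactly $p$ time. The completion time $C_j$ of job $j$ is the earliest point in time at which it has been processed for $p$ time. The objective $F=F(C_1,\dots,C_n)$ is increasing in the completion times: if $C_j\le C_j'$ for all $j$ with strict inequality for at least one $j$, then $F(C_1,\dots,C_n)<F(C_1',\dots,C_n')$. A schedule is optimal if it is feasible and minimizes $F$ among all feasible schedules. Standing assumption: optimal schedules contain no idle time, i.e. with $T=np$ (the time horizon) and time measured from the start of processing, the machine is busy throughout $(0,T]$. Job-parts and time intervals: each job $j$ is separated into $p$ job-parts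 $j.1,\dots,j.p$ of unit length, in the order in which they are processed ($j.k$ is the $k$-th unit of processing of job $j$), and time is separated into the time intervals $1,2,\dots,T$, where $t$ stands for the time interval $(t-1,t]$. A job-part is assigned to time interval $t$ if it is processed entirely in $(t-1,t]$; in an optimal schedule every job-part is assigned to one time interval in this sense. *)

theory Defs
  imports "HOL-Analysis.Analysis"
begin

text \<open>
  The jobs are the elements of a finite type \<open>'j\<close>, so \<open>n = CARD('j)\<close>. A schedule gives, for each
  job, the set of points in time at which it is processed. A point \<open>x\<close> stands for the time
  just before \<open>x\<close>, since all sets are built from intervals of the form \<open>(a, b]\<close>.
\<close>

type_synonym 'j schedule = "'j \<Rightarrow> real set"

definition finite_interval_union :: "real set \<Rightarrow> bool" where
  "finite_interval_union A \<longleftrightarrow> (\<exists>I. finite I \<and> A = (\<Union>(a, b)\<in>I. {a<..b}))"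

definition is_schedule :: "'j schedule \<Rightarrow> bool" where
  "is_schedule S \<longleftrightarrow> (\<forall>j. finite_interval_union (S j)) \<and> disjoint_family S"

definition processed :: "'j schedule \<Rightarrow> 'j \<Rightarrow> real \<Rightarrow> real" where
  "processed S j x = measure lborel (S j \<inter> {..x})"

text \<open>
  Release at \<open>r j\<close> excludes the point \<open>r j\<close> itself: an interval \<open>(a, b]\<close> lies in \<open>(r j, \<infinity>)\<close>
  iff it is empty or \<open>a \<ge> r j\<close>.
\<close>

definition feasible :: "('j \<Rightarrow> nat) \<Rightarrow> nat \<Rightarrow> 'j schedule \<Rightarrow> bool" where
  "feasible r p S \<longleftrightarrow> is_schedule S \<and>
     (\<forall>j. S j \<subseteq> {real (r j)<..} \<and> measure lborel (S j) = real p)"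

definition completion_time :: "nat \<Rightarrow> 'j schedule \<Rightarrow> 'j \<Rightarrow> real" where
  "completion_time p S j = (LEAST x. processed S j x = real p)"

text \<open>
  The order on \<open>'j \<Rightarrow> real\<close> is pointwise, so \<open>C < C'\<close> means \<open>C j \<le> C' j\<close> for all \<open>j\<close> with strict
  inequality for at least one \<open>j\<close>. Monotonicity is required only for positive arguments, as
  completion times are positive; thus objectives such as the sum of the squares of the
  completion times are covered.
\<close>

definition increasing_objective :: "(('j \<Rightarrow> real) \<Rightarrow> real) \<Rightarrow> bool" where
  "increasing_objective F \<longleftrightarrow> strict_mono_on {C. \<forall>j. 0 < C j} F"

definition optimal :: "('j \<Rightarrow> nat) \<Rightarrow> nat \<Rightarrow> (('j \<Rightarrow> real) \<Rightarrow> real) \<Rightarrow> 'j schedule \<Rightarrow> bool" where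
  "optimal r p F S \<longleftrightarrow> feasible r p S \<and>
     (\<forall>S'. feasible r p S' \<longrightarrow> F (completion_time p S) \<le> F (completion_time p S'))"

definition horizon :: "'j::finite itself \<Rightarrow> nat \<Rightarrow> nat" where
  "horizon _ p = CARD('j) * p"

definition no_idle_time :: "nat \<Rightarrow> 'j::finite schedule \<Rightarrow> bool" where
  "no_idle_time p S \<longleftrightarrow> {0<..real (horizon TYPE('j) p)} \<subseteq> (\<Union>j. S j)"

text \<open>The \<open>k\<close>-th unit of processing of job \<open>j\<close>, for \<open>k\<close> from \<open>1\<close> to \<open>p\<close>.\<close>

definition job_part :: "'j schedule \<Rightarrow> 'j \<Rightarrow> nat \<Rightarrow> real set" where
  "job_part S j k = {x \<in> S j. real k - 1 < processed S j x \<and> processed S j x \<le> real k}"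

definition assigned :: "nat \<Rightarrow> 'j::finite schedule \<Rightarrow> 'j \<Rightarrow> nat \<Rightarrow> nat \<Rightarrow> bool" where
  "assigned p S j k t \<longleftrightarrow>
     t \<in> {1..horizon TYPE('j) p} \<and> job_part S j k \<subseteq> {real t - 1<..real t}"

end

theory Submission
  imports Defs
begin

text \<open>
  The reason behind the theorem is a property of optimal schedules that holds at arbitrary real
  times: of two available jobs, the one that completes earlier has priority. If \<open>i\<close> completes
  before \<open>j\<close> and \<open>j\<close> runs at a time when \<open>i\<close> is released but unfinished, then trading a short
  piece of \<open>j\<close> there for the equally long final piece of \<open>i\<close> completes \<open>i\<close> strictly earlier and
  delays no job, so the objective decreases (\<open>earlier_completing_job_has_priority\<close>).

  Now let \<open>j\<close> run before and after a gap, and let \<open>i\<close> run inside the gap. If \<open>j\<close> were the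
  first of the two to complete, it would have priority over \<open>i\<close> from its release on, whereas \<open>i\<close>
  runs while \<open>j\<close> is released and unfinished. Hence \<open>i\<close> completes first, and
  by priority \<open>j\<close> never runs between the release and the completion of \<open>i\<close>. So \<open>i\<close> is
  released no earlier than the gap begins and completes no later than the gap ends
  (\<open>job_in_gap_released_and_completed_in_gap\<close>). Since the machine is never idle, the gap is a
  disjoint union of whole jobs, and its length is \<open>p\<close> times their number.

  It remains to see that consecutive job-parts assigned to \<open>t\<close> and \<open>t'\<close> do bound such a gap. A
  job-part has measure \<open>1\<close> and is a finite union of half-open intervals, so it fills the unit
  interval that it is assigned to (\<open>assigned_job_part_fills_interval\<close>), and no processing of \<open>j\<close>
  falls between two consecutive parts.
\<close>

section \<open>Finite unions of half-open intervals\<close>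

lemma finite_interval_union_empty [simp]: "finite_interval_union {}"
  unfolding finite_interval_union_def by (rule exI[of _ "{}"]) simp

lemma finite_interval_union_interval [simp]: "finite_interval_union {a<..b}"
  unfolding finite_interval_union_def by (rule exI[of _ "{(a, b)}"]) simp

lemma finite_interval_union_Un:
  assumes "finite_interval_union A" "finite_interval_union B"
  shows "finite_interval_union (A \<union> B)"
proof -
  from assms obtain I J where "finite I" "A = (\<Union>(a, b)\<in>I. {a<..b})"
    "finite J" "B = (\<Union>(a, b)\<in>J. {a<..b})"
    unfolding finite_interval_union_def by blast
  then have "finite (I \<union> J)" "A \<union> B = (\<Union>(a, b)\<in>I \<union> J. {a<..b})" by auto
  then show ?thesis unfolding finite_interval_union_def by blast
qed

lemma finite_interval_union_UN:
  assumes "finite I" "\<And>i. i \<in> I \<Longrightarrow> finite_interval_union (A i)"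
  shows "finite_interval_union (\<Union>i\<in>I. A i)"
  using assms by (induction I rule: finite_induct) (auto intro: finite_interval_union_Un)

lemma finite_interval_union_Diff:
  assumes "finite_interval_union A" "finite_interval_union B"
  shows "finite_interval_union (A - B)"
proof -
  have diff_interval: "finite_interval_union (C - {c<..d})"
    if C: "finite_interval_union C" for C c d
  proof -
    from C obtain I where I: "finite I" "C = (\<Union>(a, b)\<in>I. {a<..b})"
      unfolding finite_interval_union_def by blast
    then have "C - {c<..d} = (\<Union>q\<in>I. {fst q<..min (snd q) c} \<union> {max (fst q) d<..snd q})"
      by fastforce
    then show ?thesis using I(1)
      by (simp add: finite_interval_union_UN finite_interval_union_Un)
  qed
  from assms(2) obtain J where J: "finite J" "B = (\<Union>(a, b)\<in>J. {a<..b})"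
    unfolding finite_interval_union_def by blast
  from J(1) have "finite_interval_union (A - (\<Union>(a, b)\<in>J. {a<..b}))"
  proof (induction J rule: finite_induct)
    case empty
    then show ?case using assms(1) by simp
  next
    case (insert q J)
    have "A - (\<Union>(a, b)\<in>insert q J. {a<..b}) =
        (A - (\<Union>(a, b)\<in>J. {a<..b})) - {fst q<..snd q}"
      by (auto simp: case_prod_unfold)
    then show ?case using diff_interval[OF insert.IH] by simp
  qed
  then show ?thesis using J(2) by simp
qed

lemma finite_interval_union_Int:
  assumes "finite_interval_union A" "finite_interval_union B"
  shows "finite_interval_union (A \<inter> B)"
  using assms by (simp add: finite_interval_union_Diff Diff_Diff_Int[symmetric])

lemma finite_interval_union_fmeasurable:
  assumes "finite_interval_union A"
  shows "A \<in> fmeasurable lborel"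
proof -
  from assms obtain I where "finite I" "A = (\<Union>(a, b)\<in>I. {a<..b})"
    unfolding finite_interval_union_def by blast
  moreover have "{a<..b} \<in> fmeasurable lborel" for a b :: real
    by (rule fmeasurableI) (simp_all add: emeasure_bounded_finite[unfolded infinity_ennreal_def])
  ultimately show ?thesis by (auto intro!: fmeasurable.finite_UN)
qed

lemma finite_interval_union_left_open:
  assumes "finite_interval_union A" "x \<in> A"
  obtains e where "0 < e" "\<And>d. d \<le> e \<Longrightarrow> {x - d<..x} \<subseteq> A"
proof -
  from assms obtain I a b where "A = (\<Union>(a, b)\<in>I. {a<..b})" "(a, b) \<in> I" "a < x" "x \<le> b"
    unfolding finite_interval_union_def by auto
  then show ?thesis by (intro that[of "x - a"]) fastforce+
qed

lemma finite_interval_union_has_max: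
  assumes "finite_interval_union A" "A \<noteq> {}"
  obtains m where "m \<in> A" "\<And>x. x \<in> A \<Longrightarrow> x \<le> m"
proof -
  from assms obtain I where I: "finite I" "A = (\<Union>(a, b)\<in>I. {a<..b})"
    unfolding finite_interval_union_def by blast
  define B where "B = snd ` {q \<in> I. fst q < snd q}"
  have mem: "\<exists>b\<in>B. x \<le> b" if x: "x \<in> A" for x
  proof -
    from x obtain a b where ab: "(a, b) \<in> I" "a < x" "x \<le> b" unfolding I(2) by auto
    then have "b \<in> B" unfolding B_def by force
    then show ?thesis using ab(3) by blast
  qed
  have B: "finite B" "B \<noteq> {}" using I(1) assms(2) mem by (auto simp: B_def)
  have "Max B \<in> B" using B by simp
  then obtain q where "q \<in> I" "fst q < snd q" "Max B = snd q" unfolding B_def by auto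
  then have "Max B \<in> A" unfolding I(2) by (intro UN_I[of q]) (auto simp: case_prod_unfold)
  moreover have "x \<le> Max B" if "x \<in> A" for x
    using mem[OF that] B(1) Max_ge order_trans by blast
  ultimately show ?thesis using that by blast
qed

text \<open>
  Half-openness leaves no room for exceptional points, so measures determine these sets exactly
  and not only almost everywhere.
\<close>

lemma null_finite_interval_union_empty:
  assumes "finite_interval_union A" "measure lborel A = 0"
  shows "A = {}"
proof (rule ccontr)
  assume "A \<noteq> {}"
  then obtain x where "x \<in> A" by blast
  then obtain e where e: "0 < e" "\<And>d. d \<le> e \<Longrightarrow> {x - d<..x} \<subseteq> A"
    using finite_interval_union_left_open assms(1) by blast
  have "measure lborel {x - e<..x} \<le> measure lborel A"
    using e(2)[of e] finite_interval_union_fmeasurable[OF assms(1)]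
    by (intro measure_mono_fmeasurable) auto
  then show False using e(1) assms(2) by simp
qed

section \<open>Processing and completion\<close>

lemma is_schedule_finite_interval_union: "is_schedule S \<Longrightarrow> finite_interval_union (S j)"
  by (simp add: is_schedule_def)

lemma processed_diff:
  assumes "is_schedule S" "x \<le> y"
  shows "processed S j y - processed S j x = measure lborel (S j \<inter> {x<..y})"
proof -
  have A: "S j \<in> fmeasurable lborel" 
    by (rule finite_interval_union_fmeasurable[OF is_schedule_finite_interval_union[OF assms(1)]])
  then have "measure lborel (S j \<inter> {..x} \<union> S j \<inter> {x<..y}) =
      measure lborel (S j \<inter> {..x}) + measure lborel (S j \<inter> {x<..y})"
    by (intro measure_Un2[THEN trans])
       (auto intro!: fmeasurable_Int_fmeasurable arg_cong[where f = "measure lborel"])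
  moreover have "S j \<inter> {..x} \<union> S j \<inter> {x<..y} = S j \<inter> {..y}" using assms(2) by auto
  ultimately show ?thesis unfolding processed_def by simp
qed

lemma processed_mono:
  assumes "is_schedule S" "x \<le> y"
  shows "processed S j x \<le> processed S j y"
  using processed_diff[OF assms, of j] measure_nonneg[of lborel "S j \<inter> {x<..y}"] by linarith

lemma processed_less:
  assumes "is_schedule S" "x < y" "y \<in> S j"
  shows "processed S j x < processed S j y"
proof -
  have "S j \<inter> {x<..y} \<noteq> {}" using assms by auto
  then have "measure lborel (S j \<inter> {x<..y}) \<noteq> 0"
    using null_finite_interval_union_empty
      finite_interval_union_Int[OF is_schedule_finite_interval_union[OF assms(1)]
        finite_interval_union_interval] by blast
  then show ?thesis
    using processed_diff[OF assms(1), of x y j] assms(2) measure_nonneg[of lborel "S j \<inter> {x<..y}"]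
    by linarith
qed

lemma processed_Lipschitz:
  assumes "is_schedule S" "x \<le> y"
  shows "processed S j y - processed S j x \<le> y - x"
proof -
  have "measure lborel (S j \<inter> {x<..y}) \<le> measure lborel {x<..y}"
    using is_schedule_finite_interval_union[OF assms(1), of j]
      finite_interval_union_fmeasurable[OF finite_interval_union_interval[of x y]]
    by (intro measure_mono_fmeasurable fmeasurableD finite_interval_union_fmeasurable
        finite_interval_union_Int) auto
  then show ?thesis using processed_diff[OF assms, of j] assms(2) by simp
qed

lemma continuous_processed:
  assumes "is_schedule S"
  shows "continuous_on A (processed S j)"
proof -
  have "1-lipschitz_on A (processed S j)"
  proof (rule lipschitz_onI)
    fix x y :: real
    show "dist (processed S j x) (processed S j y) \<le> 1 * dist x y"
      using processed_Lipschitz[OF assms, of x y] processed_Lipschitz[OF assms, of y x]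
        processed_mono[OF assms, of x y] processed_mono[OF assms, of y x]
      by (cases "x \<le> y") (simp_all add: dist_real_def)
  qed simp
  then show ?thesis by (rule lipschitz_on_continuous_on)
qed

lemma feasible_is_schedule: "feasible r p S \<Longrightarrow> is_schedule S"
  by (simp add: feasible_def)

lemma feasible_same_job:
  "feasible r p S \<Longrightarrow> x \<in> S i \<Longrightarrow> x \<in> S j \<Longrightarrow> i = j"
  by (auto simp: feasible_def is_schedule_def disjoint_family_on_def)

lemma feasible_after_release:
  "feasible r p S \<Longrightarrow> x \<in> S j \<Longrightarrow> real (r j) < x"
  by (auto simp: feasible_def)

text \<open>
  A nonempty finite union of intervals \<open>(a, b]\<close> contains its supremum, so a job is being
  processed at its completion time. In particular different jobs complete at different times.
\<close>

lemma completion_time_is_max: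
  assumes "feasible r p S" "0 < p"
  shows "completion_time p S j \<in> S j" "x \<in> S j \<Longrightarrow> x \<le> completion_time p S j"
proof -
  note sched = feasible_is_schedule[OF assms(1)]
  have meas: "measure lborel (S j) = real p" using assms(1) by (simp add: feasible_def)
  then have "S j \<noteq> {}" using assms(2) by auto
  then obtain m where m: "m \<in> S j" "\<And>x. x \<in> S j \<Longrightarrow> x \<le> m"
    using finite_interval_union_has_max[OF is_schedule_finite_interval_union[OF sched]] by blast
  have "S j \<inter> {..m} = S j" using m(2) by auto
  then have pm: "processed S j m = real p" unfolding processed_def using meas by simp
  have "completion_time p S j = m"
    unfolding completion_time_def
  proof (rule Least_equality[where P = "\<lambda>x. processed S j x = real p", OF pm])
    fix y assume "processed S j y = real p"
    then show "m \<le> y" using processed_less[OF sched _ m(1), of y] pm by linarith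
  qed
  then show "completion_time p S j \<in> S j" "x \<in> S j \<Longrightarrow> x \<le> completion_time p S j"
    using m by auto
qed

section \<open>The exchange argument\<close>

lemma measure_replace_disjoint:
  assumes "A \<in> fmeasurable M" "B \<in> fmeasurable M" "C \<in> fmeasurable M"
    and "B \<subseteq> A" "A \<inter> C = {}"
  shows "measure M (A - B \<union> C) = measure M A - measure M B + measure M C"
proof -
  have "measure M (A - B \<union> C) = measure M (A - B) + measure M C"
    using assms by (subst measure_Un2) (auto intro!: arg_cong[where f = "measure M"])
  moreover have "measure M (A - B) = measure M A - measure M B"
    using assms by (intro measure_Diff) (auto simp: fmeasurable_def)
  ultimately show ?thesis by simp
qed

text \<open>
  The final piece of \<open>i\<close> moves to the left and takes the place of a piece of \<open>j\<close>, which makes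
  \<open>C i\<close> smaller; the piece of \<open>j\<close> moves to the right, but only up to the old \<open>C i\<close>, which lies
  before \<open>C j\<close>. Half-openness provides pieces of positive length ending at \<open>x\<close> and at \<open>C i\<close>.
\<close>

lemma earlier_completing_job_has_priority:
  assumes opt: "optimal r p F S" and p: "0 < p" and F: "increasing_objective F"
    and lt: "completion_time p S i < completion_time p S j"
    and x: "x \<in> S j" "real (r i) < x"
  shows "completion_time p S i < x"
proof (rule ccontr)
  define c where "c = completion_time p S i"
  have feas: "feasible r p S" using opt by (simp add: optimal_def)
  note fiu = is_schedule_finite_interval_union[OF feasible_is_schedule[OF feas]]
  note C = completion_time_is_max[OF feas p]
  have ij: "i \<noteq> j" using lt by auto
  have c: "c \<in> S i" using C(1) c_def by simp
  assume "\<not> completion_time p S i < x"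
  then have xc: "x < c" using feasible_same_job[OF feas c, of j] x ij c_def
    by (cases "x = c") auto
  obtain e1 where e1: "0 < e1" "\<And>d. d \<le> e1 \<Longrightarrow> {x - d<..x} \<subseteq> S j"
    using finite_interval_union_left_open[OF fiu x(1)] by blast
  obtain e2 where e2: "0 < e2" "\<And>d. d \<le> e2 \<Longrightarrow> {c - d<..c} \<subseteq> S i"
    using finite_interval_union_left_open[OF fiu c] by blast
  \<comment> \<open>The last two bounds keep the two pieces apart and keep \<open>i\<close> behind its release time.\<close>
  define e where "e = Min {e1, e2, c - x, x - real (r i)}"
  have e: "0 < e" "e \<le> e1" "e \<le> e2" "e \<le> c - x" "e \<le> x - real (r i)"
    using e1(1) e2(1) xc x(2) by (auto simp: e_def)
  define J where "J = {x - e<..x}"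
  define I where "I = {c - e<..c}"
  have J: "J \<subseteq> S j" and I: "I \<subseteq> S i" using e1(2) e2(2) e by (auto simp: J_def I_def)
  define S' where "S' = S(i := S i - I \<union> J, j := S j - J \<union> I)"
  have S'i: "S' i = S i - I \<union> J" and S'j: "S' j = S j - J \<union> I"
    and S'k: "\<And>k. k \<noteq> i \<Longrightarrow> k \<noteq> j \<Longrightarrow> S' k = S k"
    using ij by (auto simp: S'_def)
  have disj: "S k \<inter> S l = {}" if "k \<noteq> l" for k l
    using feasible_same_job[OF feas] that by blast
  have "finite_interval_union (S' k)" for k
    using fiu S'i S'j S'k[of k]
    by (cases "k = i"; cases "k = j")
       (auto simp: I_def J_def intro!: finite_interval_union_Un finite_interval_union_Diff)
  moreover have "disjoint_family S'"
    unfolding disjoint_family_on_def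
  proof (intro ballI impI)
    fix k l :: 'a assume kl: "k \<noteq> l"
    show "S' k \<inter> S' l = {}"
      using kl disj[of i j] disj[of k l] disj[of k i] disj[of k j] disj[of l i] disj[of l j]
        I J S'i S'j S'k[of k] S'k[of l] ij
      by (cases "k = i"; cases "k = j"; cases "l = i"; cases "l = j") auto
  qed
  moreover have "S' k \<subseteq> {real (r k)<..}" for k
  proof -
    have "S k \<subseteq> {real (r k)<..}" using feas by (simp add: feasible_def)
    moreover have "J \<subseteq> {real (r i)<..}" using e by (auto simp: J_def)
    moreover have "I \<subseteq> {real (r j)<..}"
      using e feasible_after_release[OF feas x(1)] by (auto simp: I_def)
    ultimately show ?thesis using S'i S'j S'k[of k] by (cases "k = i"; cases "k = j") auto
  qed
  moreover have "measure lborel (S' k) = real p" for k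
  proof -
    have fm: "S l \<in> fmeasurable lborel" "J \<in> fmeasurable lborel" "I \<in> fmeasurable lborel" for l
      using finite_interval_union_fmeasurable fiu by (auto simp: I_def J_def)
    have "measure lborel I = measure lborel J" using e by (simp add: I_def J_def)
    moreover have "S i \<inter> J = {}" "S j \<inter> I = {}" using disj[OF ij] I J by auto
    ultimately have "measure lborel (S' i) = measure lborel (S i)"
      "measure lborel (S' j) = measure lborel (S j)"
      unfolding S'i S'j using fm I J by (simp_all add: measure_replace_disjoint)
    then show ?thesis using S'k[of k] feas by (cases "k = i"; cases "k = j") (auto simp: feasible_def)
  qed
  ultimately have feas': "feasible r p S'" by (simp add: feasible_def is_schedule_def)
  note C' = completion_time_is_max[OF feas' p]
  have Ci: "completion_time p S' i < completion_time p S i"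
  proof -
    have "y \<le> c - e" if "y \<in> S' i" for y
      using that C(2)[of y i] e unfolding S'i by (auto simp: I_def J_def c_def)
    then show ?thesis using C'(1)[of i] e(1) c_def by fastforce
  qed
  have "completion_time p S' k \<le> completion_time p S k" for k
  proof -
    have "y \<le> completion_time p S k" if "y \<in> S' k" for y
    proof (cases "k = j")
      case True
      then show ?thesis using that C(2)[of y j] lt unfolding True S'j by (auto simp: I_def c_def)
    next
      case False
      have "y \<in> S k \<or> k = i \<and> y \<in> J" using that False S'i S'k[of k] by (cases "k = i") auto
      then show ?thesis using C(2)[of y k] xc by (auto simp: J_def c_def)
    qed
    then show ?thesis using C'(1) by blast
  qed
  with Ci have less: "completion_time p S' < completion_time p S"
    unfolding less_fun_def le_fun_def by (metis not_le)
  have pos: "0 < completion_time p R k" if "feasible r p R" for R k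
    using feasible_after_release[OF that completion_time_is_max(1)[OF that p], of k]
      of_nat_0_le_iff[of "r k"] by linarith
  have "F (completion_time p S') < F (completion_time p S)"
    by (rule strict_mono_onD[OF F[unfolded increasing_objective_def] _ _ less])
      (simp_all add: pos[OF feas] pos[OF feas'])
  moreover have "F (completion_time p S) \<le> F (completion_time p S')"
    using opt feas' by (simp add: optimal_def)
  ultimately show False by simp
qed

text \<open>
  Here \<open>(a, b]\<close> is the gap. Both bounds come from priority of \<open>i\<close> over \<open>j\<close>: were \<open>i\<close> released
  before \<open>a\<close>, or still unfinished at \<open>b\<close>, then \<open>j\<close> would run at \<open>a\<close>, or just after \<open>b\<close>, at the
  expense of \<open>i\<close>. That \<open>j\<close> runs immediately after \<open>b\<close> is what makes the right bound sharp.
\<close>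

lemma job_in_gap_released_and_completed_in_gap:
  assumes opt: "optimal r p F S" and p: "0 < p" and F: "increasing_objective F"
    and ij: "i \<noteq> j" and a: "a \<in> S j" and x: "x \<in> S i" "a < x" "x \<le> b"
    and after: "{b<..b'} \<subseteq> S j" "b < b'"
  shows "S i \<subseteq> {a<..b}"
proof -
  have feas: "feasible r p S" using opt by (simp add: optimal_def)
  note C = completion_time_is_max[OF feas p]
  note priority = earlier_completing_job_has_priority[OF opt p F]
  have b': "b' \<in> S j" using after by auto
  have "\<not> completion_time p S j < completion_time p S i"
    using priority[of j i x] x a feasible_after_release[OF feas a] C(2)[OF b'] after(2) by auto
  moreover have "completion_time p S i \<noteq> completion_time p S j"
    using C(1)[of i] C(1)[of j] feasible_same_job[OF feas] ij by metis
  ultimately have lt: "completion_time p S i < completion_time p S j" by simp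
  have "a \<le> real (r i)"
    using priority[OF lt a] C(2)[OF x(1)] x(2) by linarith
  moreover have "completion_time p S i \<le> b"
  proof (rule ccontr)
    \<comment> \<open>Otherwise \<open>j\<close> would run right after \<open>b\<close> while \<open>i\<close> is released but unfinished.\<close>
    assume "\<not> completion_time p S i \<le> b"
    define y where "y = min b' (completion_time p S i)"
    have "y \<in> S j" using after \<open>\<not> completion_time p S i \<le> b\<close> by (auto simp: y_def)
    moreover have "real (r i) < y"
      using feasible_after_release[OF feas x(1)] x(3) after(2) \<open>\<not> completion_time p S i \<le> b\<close>
      by (auto simp: y_def)
    ultimately show False using priority[OF lt] by (fastforce simp: y_def)
  qed
  ultimately show ?thesis
    using feasible_after_release[OF feas] C(2) by (force intro: order_trans)
qed

section \<open>Job-parts\<close>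

text \<open>
  The times in \<open>S j\<close> at which at most \<open>s\<close> units have been processed are those up to any time
  \<open>y\<close> at which exactly \<open>s\<close> units have been processed, since the processed amount grows strictly
  up to every point of \<open>S j\<close>. Hence a job-part is cut out of \<open>S j\<close> by an interval.
\<close>

lemma job_part_as_intersection:
  assumes feas: "feasible r p S" and k: "k \<in> {1..p}"
  obtains y y' where "job_part S j k = S j \<inter> {y<..y'}" "measure lborel (job_part S j k) = 1"
proof -
  have p: "0 < p" using k by auto
  note sched = feasible_is_schedule[OF feas]
  define c where "c = completion_time p S j"
  note C = completion_time_is_max(2)[OF feas p, of _ j, folded c_def]
  have "S j \<inter> {..0} = {}" using feasible_after_release[OF feas, of _ j] by fastforce
  then have P0: "processed S j 0 = 0" by (simp add: processed_def)
  have "S j \<inter> {..c} = S j" using C by auto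
  then have Pc: "processed S j c = real p" using feas by (simp add: processed_def feasible_def)
  have c0: "0 \<le> c"
    using feasible_after_release[OF feas, of c j] completion_time_is_max(1)[OF feas p, of j]
      of_nat_0_le_iff[of "r j"] unfolding c_def by linarith
  have ex: "\<exists>y. processed S j y = s" if "0 \<le> s" "s \<le> real p" for s
    using IVT'[of "processed S j" 0 s c] that P0 Pc c0 continuous_processed[OF sched] by auto
  obtain y y' where y: "processed S j y = real k - 1" "processed S j y' = real k"
    using ex[of "real k - 1"] ex[of "real k"] k by auto
  have iff: "processed S j z \<le> processed S j w \<longleftrightarrow> z \<le> w" if "z \<in> S j" for z w
    using processed_mono[OF sched, of z w j]
      processed_less[OF sched _ that, of w] by linarith
  have part: "job_part S j k = S j \<inter> {y<..y'}"
  proof -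
    have "real k - 1 < processed S j x \<longleftrightarrow> y < x" "processed S j x \<le> real k \<longleftrightarrow> x \<le> y'"
      if "x \<in> S j" for x
      using iff[OF that, of y] iff[OF that, of y'] y by linarith+
    then show ?thesis unfolding job_part_def by auto
  qed
  have "y \<le> y'" using processed_mono[OF sched, of y' y j] y by linarith
  then have "measure lborel (job_part S j k) = 1"
    using processed_diff[OF sched, of y y' j] y part by simp
  then show ?thesis using that part by blast
qed

lemma assigned_job_part_fills_interval:
  fixes S :: "'j::finite schedule"
  assumes feas: "feasible r p S" and k: "k \<in> {1..p}" and asg: "assigned p S j k t"
  shows "job_part S j k = {real t - 1<..real t}"
proof -
  obtain y y' where part: "job_part S j k = S j \<inter> {y<..y'}" "measure lborel (job_part S j k) = 1"
    using job_part_as_intersection[OF feas k] by blast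
  have sub: "job_part S j k \<subseteq> {real t - 1<..real t}" using asg by (simp add: assigned_def)
  have fiu: "finite_interval_union (job_part S j k)"
    unfolding part(1)
    by (intro finite_interval_union_Int is_schedule_finite_interval_union
        feasible_is_schedule[OF feas] finite_interval_union_interval)
  have "measure lborel ({real t - 1<..real t} - job_part S j k) =
      measure lborel {real t - 1<..real t} - measure lborel (job_part S j k)"
    using sub finite_interval_union_fmeasurable[OF fiu]
    by (intro measure_Diff) (auto simp: fmeasurable_def)
  then have "measure lborel ({real t - 1<..real t} - job_part S j k) = 0"
    using part(2) by simp
  \<comment> \<open>The unfilled remainder is again a finite union of half-open intervals, so being null it is
    empty.\<close>
  then have "{real t - 1<..real t} - job_part S j k = {}"
    by (rule null_finite_interval_union_empty[rotated])
      (simp add: finite_interval_union_Diff fiu)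
  then show ?thesis using sub by blast
qed

section \<open>The gap between consecutive job-parts\<close>

theorem corollary2p2:
  fixes r :: "'j::finite \<Rightarrow> nat" and p :: nat
    and F :: "('j \<Rightarrow> real) \<Rightarrow> real"
    and S :: "'j schedule" and j :: 'j and k t t' :: nat
  assumes "0 < p"
    and "increasing_objective F"
    and "\<And>S'. optimal r p F S' \<Longrightarrow> no_idle_time p S'"
    and "optimal r p F S"
    and "k \<in> {1..p - 1}"
    and "assigned p S j k t"
    and "assigned p S j (k + 1) t'"
  shows "\<exists>m::nat. int t' - int t - 1 = int m * int p"
proof -
  have feas: "feasible r p S" using assms(4) by (simp add: optimal_def)
  note sched = feasible_is_schedule[OF feas]
  have part: "job_part S j k = {real t - 1<..real t}"
    using assigned_job_part_fills_interval[OF feas _ assms(6)] assms(1,5) by auto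
  have part': "job_part S j (k + 1) = {real t' - 1<..real t'}"
    using assigned_job_part_fills_interval[OF feas _ assms(7)] assms(1,5) by auto
  have "real t \<in> job_part S j k" using part by simp
  then have t: "real t \<in> S j" "real k - 1 < processed S j (real t)"
    "processed S j (real t) \<le> real k"
    by (auto simp: job_part_def)
  have "real t' \<in> job_part S j (k + 1)" using part' by simp
  then have t': "real t' \<in> S j" "real k < processed S j (real t')"
    "processed S j (real t') \<le> real k + 1"
    by (auto simp: job_part_def)
  have "t < t'" using t(3) t'(2) processed_mono[OF sched, of "real t'" "real t" j] by fastforce
  then have le: "real t \<le> real t' - 1" by linarith
  define gap where "gap = {real t<..real t' - 1}"
  \<comment> \<open>A time at which \<open>j\<close> runs in the gap would belong to one of the two parts.\<close>
  have not_j: "x \<notin> gap" if "x \<in> S j" for x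
  proof
    assume x: "x \<in> gap"
    have "real k - 1 < processed S j x" "processed S j x \<le> real k + 1"
      using x t(2) t'(3) processed_mono[OF sched, of "real t" x j]
        processed_mono[OF sched, of x "real t'" j] by (auto simp: gap_def)
    then have "x \<in> job_part S j k \<union> job_part S j (k + 1)"
      using that by (auto simp: job_part_def)
    then show False unfolding part part' using x by (auto simp: gap_def)
  qed
  have whole: "S i \<subseteq> gap" if "x \<in> S i" "x \<in> gap" for i x
  proof -
    have "{real t' - 1<..real t'} \<subseteq> S j" using part' by (auto simp: job_part_def)
    then show ?thesis
      using job_in_gap_released_and_completed_in_gap[OF assms(4,1,2), of i j "real t" x "real t' - 1"
          "real t'"] that t(1) not_j[of x] by (auto simp: gap_def)
  qed
  define G where "G = {i. S i \<inter> gap \<noteq> {}}"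
  have "real t' \<le> real (horizon TYPE('j) p)" using assms(7) by (simp add: assigned_def)
  then have "gap \<subseteq> {0<..real (horizon TYPE('j) p)}" by (auto simp: gap_def)
  then have "gap \<subseteq> (\<Union>i. S i)"
    using assms(3)[OF assms(4)] by (auto simp: no_idle_time_def)
  then have gap: "gap = (\<Union>i\<in>G. S i)" using whole by (fastforce simp: G_def)
  have "measure lborel gap = (\<Sum>i\<in>G. measure lborel (S i))"
    unfolding gap
  proof (rule measure_finite_Union)
    have fm: "S i \<in> fmeasurable lborel" for i
      by (rule finite_interval_union_fmeasurable[OF is_schedule_finite_interval_union[OF sched]])
    show "S ` G \<subseteq> sets lborel" using fmeasurableD[OF fm] by blast
    show "emeasure lborel (S i) \<noteq> \<infinity>" for i using fmeasurableD2[OF fm] by simp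
    show "disjoint_family_on S G" using feasible_same_job[OF feas]
      by (auto simp: disjoint_family_on_def)
  qed simp
  also have "\<dots> = real (card G * p)" using feas by (simp add: feasible_def)
  finally have "real t' - 1 - real t = real (card G * p)" using le by (simp add: gap_def)
  then have "real t' = real (t + 1 + card G * p)" by simp
  then have "t' = t + 1 + card G * p" unfolding of_nat_eq_iff .
  then have "int t' - int t - 1 = int (card G) * int p" by simp
  then show ?thesis by blast
qed

end
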